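(* Assume $1<|\mathcal X|<|\mathcal Y|$ and $\mathcal W_\kappa(\mathcal Y,\mathcal E)\neq\emptyset$. For $(x_0,x_0')\in\mathcal U$ let $G^{\uparrow}_{x_0,x_0'}\in\mathcal F(\mathcal Y,\mathcal E)$ be the indicator function of the anchor set $E_{x_0,x_0'}$, i.e. $G^\uparrow_{x_0,x_0'}(y,y')=1$ if $(y,y')\in E_{x_0,x_0'}$ and $0$ otherwise, and for $(y_0,y_0')\in\mathcal R$ let $G^\uparrow_{y_0,y_0'}\in\mathcal F(\mathcal Y,\mathcal E)$ be the indicator function of the single edge $(y_0,y_0')$. Then the system of functions $$\mathcal B_\kappa(\mathcal Y,\mathcal E)=\{G^\uparrow_{x_0,x_0'}:(x_0,x_0')\in\mathcal U\}\cup\{G^\uparrow_{y_0,y_0'}:(y_0,y_0')\in\mathcal R\}$$ forms a basis of $\operatorname{span}(\mathcal G_\kappa(\mathcal Y,\mathcal E))$, and $\dim\operatorname{span}(\mathcal G_\kappa(\mathcal Y,\mathcal E))=|\mathcal U|+|\mathcal R|$.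
   Context: Let $\mathcal Y$ be a finite set and $\mathcal E\subset\mathcal Y^2$ a nonempty edge set such that the digraph $(\mathcal Y,\mathcal E)$ is strongly connected. $\mathcal F(\mathcal Y,\mathcal E)=\mathbb R^{\mathcal E}$ is the space of real functions on $\mathcal E$, identified with real $\mathcal Y\times\mathcal Y$ matrices vanishing outside $\mathcal E$; $\mathcal F^+(\mathcal Y,\mathcal E)$ is the subset of those that are strictly positive on $\mathcal E$; $\mathcal W(\mathcal Y,\mathcal E)\subset\mathcal F^+(\mathcal Y,\mathcal E)$ is the set of row-stochastic ones. Let $\kappa\colon\mathcal Y\to\mathcal X$ be surjective, $\mathcal S_x=\kappa^{-1}(x)$, $\mathcal D=\{(\kappa(y),\kappa(y')):(y,y')\in\mathcal E\}$, and write $F(y,\mathcal S_{x'})=\sum_{y'\in\mathcal S_{x'}}F(y,y')$. $F\in\mathcal F(\mathcal Y,\mathcal E)$ is $\kappa$-lumpable if $F(y_1,\mathcal S_{x'})=F(y_2,\mathcal S_{x'})$ for all $(x,x')\in\mathcal D$ and $y_1,y_2\in\mathcal S_x$. $\mathcal F^+_\kappa(\mathcal Y,\mathcal E)$ and $\mathcal W_\kappa(\mathcal Y,\mathcal E)$ are the sets of $\kappa$-lumpable elements of $\mathcal F^+(\mathcal Y,\mathcal E)$ and $\mathcal W(\mathcal Y,\mathcal E)$. $\mathcal G_\kappa(\mathcal Y,\mathcal E)=\{\log F:F\in\mathcal F_\kappa^+(\mathcal Y,\mathcal E)\}\subset\mathcal F(\mathcal Y,\mathcal E)$, with $\log$ entrywise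 on $\mathcal E$; $\operatorname{span}(\mathcal G_\kappa(\mathcal Y,\mathcal E))$ is its linear span (which coincides with its affine hull). For $(x,x')\in\mathcal D$ let $\mathcal M_{x,x'}=\{y\in\mathcal S_x:\exists\, y_1'\neq y_2'\in\mathcal S_{x'},\ (y,y_1'),(y,y_2')\in\mathcal E\}$; let $\mathcal M=\{(x,x')\in\mathcal D:\mathcal M_{x,x'}\neq\emptyset\}$, $\mathcal U=\{(x,x')\in\mathcal D:\mathcal M_{x,x'}\neq\mathcal S_x\}$ and $\mathcal R=\bigcup_{(x_0,x_0')\in\mathcal M}\{(y_0,y_0')\in\mathcal M_{x_0,x_0'}\times\mathcal S_{x_0'}:(y_0,y_0')\in\mathcal E\}$. Anchors: for each $(x,x')\in\mathcal D$ one fixes an arbitrary set $E_{x,x'}\subset\mathcal E\cap(\mathcal S_x\times\mathcal S_{x'})$ of $|\mathcal S_x|$ edges containing exactly one edge with first coordinate $y$ for each $y\in\mathcal S_x$ (such a set exists when $\mathcal W_\kappa(\mathcal Y,\mathcal E)\neq\emptyset$). *)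

theory Defs
  imports "HOL-Analysis.Analysis"
begin

text \<open>
  The finite sets \<open>\<Y>\<close> and \<open>\<X>\<close> are the universes of the finite types \<open>'y\<close> and \<open>'x\<close>.  A real
  function on the edge set \<open>E\<close> is represented by the \<open>\<Y> \<times> \<Y>\<close> matrix that extends it by zero.
\<close>

definition strongly_connected_on_UNIV :: "('y \<times> 'y) set \<Rightarrow> bool" where
  "strongly_connected_on_UNIV E \<longleftrightarrow> (\<forall>y y'. (y, y') \<in> E\<^sup>*)"

definition edge_funs :: "('y \<times> 'y) set \<Rightarrow> (real^'y::finite^'y) set" where
  "edge_funs E = {F. \<forall>y y'. (y, y') \<notin> E \<longrightarrow> F $ y $ y' = 0}"

definition pos_edge_funs :: "('y \<times> 'y) set \<Rightarrow> (real^'y::finite^'y) set" where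
  "pos_edge_funs E = {F \<in> edge_funs E. \<forall>(y, y') \<in> E. F $ y $ y' > 0}"

definition stoch_edge_funs :: "('y \<times> 'y) set \<Rightarrow> (real^'y::finite^'y) set" where
  "stoch_edge_funs E = {F \<in> pos_edge_funs E. \<forall>y. (\<Sum>y'\<in>UNIV. F $ y $ y') = 1}"

definition fib :: "('y \<Rightarrow> 'x) \<Rightarrow> 'x \<Rightarrow> 'y set" where
  "fib \<kappa> x = \<kappa> -` {x}"

definition lumped_edges :: "('y \<Rightarrow> 'x) \<Rightarrow> ('y \<times> 'y) set \<Rightarrow> ('x \<times> 'x) set" where
  "lumped_edges \<kappa> E = {(\<kappa> y, \<kappa> y') | y y'. (y, y') \<in> E}"

definition lumpable :: "('y \<Rightarrow> 'x) \<Rightarrow> ('y \<times> 'y) set \<Rightarrow> real^'y::finite^'y \<Rightarrow> bool" where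
  "lumpable \<kappa> E F \<longleftrightarrow>
    (\<forall>(x, x') \<in> lumped_edges \<kappa> E. \<forall>y1 \<in> fib \<kappa> x. \<forall>y2 \<in> fib \<kappa> x.
      (\<Sum>y'\<in>fib \<kappa> x'. F $ y1 $ y') = (\<Sum>y'\<in>fib \<kappa> x'. F $ y2 $ y'))"

definition pos_lumpable :: "('y \<Rightarrow> 'x) \<Rightarrow> ('y \<times> 'y) set \<Rightarrow> (real^'y::finite^'y) set" where
  "pos_lumpable \<kappa> E = {F \<in> pos_edge_funs E. lumpable \<kappa> E F}"

definition stoch_lumpable :: "('y \<Rightarrow> 'x) \<Rightarrow> ('y \<times> 'y) set \<Rightarrow> (real^'y::finite^'y) set" where
  "stoch_lumpable \<kappa> E = {F \<in> stoch_edge_funs E. lumpable \<kappa> E F}"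

definition log_on :: "('y \<times> 'y) set \<Rightarrow> real^'y::finite^'y \<Rightarrow> real^'y^'y" where
  "log_on E F = (\<chi> y y'. if (y, y') \<in> E then ln (F $ y $ y') else 0)"

definition log_lumpable :: "('y \<Rightarrow> 'x) \<Rightarrow> ('y \<times> 'y) set \<Rightarrow> (real^'y::finite^'y) set" where
  "log_lumpable \<kappa> E = log_on E ` pos_lumpable \<kappa> E"

definition multi_rows :: "('y \<Rightarrow> 'x) \<Rightarrow> ('y \<times> 'y) set \<Rightarrow> 'x \<Rightarrow> 'x \<Rightarrow> 'y set" where
  "multi_rows \<kappa> E x x' =
    {y \<in> fib \<kappa> x. \<exists>y1 \<in> fib \<kappa> x'. \<exists>y2 \<in> fib \<kappa> x'. y1 \<noteq> y2 \<and> (y, y1) \<in> E \<and> (y, y2) \<in> E}"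

definition M_pairs :: "('y \<Rightarrow> 'x) \<Rightarrow> ('y \<times> 'y) set \<Rightarrow> ('x \<times> 'x) set" where
  "M_pairs \<kappa> E = {(x, x') \<in> lumped_edges \<kappa> E. multi_rows \<kappa> E x x' \<noteq> {}}"

definition U_pairs :: "('y \<Rightarrow> 'x) \<Rightarrow> ('y \<times> 'y) set \<Rightarrow> ('x \<times> 'x) set" where
  "U_pairs \<kappa> E = {(x, x') \<in> lumped_edges \<kappa> E. multi_rows \<kappa> E x x' \<noteq> fib \<kappa> x}"

definition R_edges :: "('y \<Rightarrow> 'x) \<Rightarrow> ('y \<times> 'y) set \<Rightarrow> ('y \<times> 'y) set" where
  "R_edges \<kappa> E =
    (\<Union>(x, x') \<in> M_pairs \<kappa> E. {(y, y') \<in> multi_rows \<kappa> E x x' \<times> fib \<kappa> x'. (y, y') \<in> E})"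

definition anchor_choice ::
  "('y \<Rightarrow> 'x) \<Rightarrow> ('y \<times> 'y) set \<Rightarrow> ('x \<Rightarrow> 'x \<Rightarrow> ('y \<times> 'y) set) \<Rightarrow> bool" where
  "anchor_choice \<kappa> E A \<longleftrightarrow>
    (\<forall>(x, x') \<in> lumped_edges \<kappa> E.
      A x x' \<subseteq> E \<inter> (fib \<kappa> x \<times> fib \<kappa> x') \<and>
      card (A x x') = card (fib \<kappa> x) \<and>
      (\<forall>y \<in> fib \<kappa> x. \<exists>!e. e \<in> A x x' \<and> fst e = y))"

definition ind_mat :: "('y \<times> 'y) set \<Rightarrow> real^'y::finite^'y" where
  "ind_mat S = (\<chi> y y'. if (y, y') \<in> S then 1 else 0)"

definition lump_basis ::
  "('y \<Rightarrow> 'x) \<Rightarrow> ('y \<times> 'y) set \<Rightarrow> ('x \<Rightarrow> 'x \<Rightarrow> ('y \<times> 'y) set) \<Rightarrow> (real^'y::finite^'y) set" where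
  "lump_basis \<kappa> E A =
    {ind_mat (A x0 x0') | x0 x0'. (x0, x0') \<in> U_pairs \<kappa> E} \<union>
    {ind_mat {(y0, y0')} | y0 y0'. (y0, y0') \<in> R_edges \<kappa> E}"

end

theory Submission
  imports Defs
begin

text \<open>
  Cut a matrix on \<open>E\<close> into blocks, one for each lumped edge \<open>(x, x')\<close>.  A positive \<open>F\<close> is lumpable iff
  within each block all rows have the same sum \<open>c\<close>.  Rows with a single edge in the block are thereby
  forced to carry the value \<open>c\<close> on that edge, while rows with several edges (which make up \<open>R_edges\<close>)
  may split \<open>c\<close> in any way.  The span of the logarithms accordingly consists of all edge functions that
  in each block take a common value on the edges outside \<open>R_edges\<close> and are arbitrary on \<open>R_edges\<close>.

  The one nonlinear point is that the constraint on the sum of a row with several edges disappears in the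
  span (\<open>ind_mat_R_edge_in_span_log\<close>): splitting the joint mass of two edges in three different
  proportions yields two independent differences of logarithms supported on these two edges.  Scaling a
  whole block then supplies the common value outside \<open>R_edges\<close> (\<open>ind_mat_block_in_span_log\<close>).

  Everything else is bookkeeping modulo functions supported on \<open>R_edges\<close>.  Every edge outside \<open>R_edges\<close> is
  the only one of its row in its block, hence lies in the anchor set (\<open>edge_outside_R\<close>).  Therefore the
  indicators of a block and of its anchor set agree modulo such functions, and so do \<open>log F\<close> and the
  combination of the anchor indicators with the coefficients \<open>ln c\<close>.  Finally, the anchor set of a pair in
  \<open>U_pairs\<close> contains such a single edge, which belongs to no other set of the system
  (\<open>anchor_private_edge\<close>); reading off entries at these edges separates the basis elements.
\<close>

section \<open>Indicator matrices\<close>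

lemma ind_mat_nth [simp]: "ind_mat S $ y $ y' = (if (y, y') \<in> S then 1 else 0)"
  by (simp add: ind_mat_def)

lemma inj_ind_mat: "inj (ind_mat :: _ \<Rightarrow> real^'y::finite^'y)"
proof (rule injI)
  fix S T :: "('y \<times> 'y) set"
  assume eq: "(ind_mat S :: real^'y^'y) = ind_mat T"
  have "(y, y') \<in> S \<longleftrightarrow> (y, y') \<in> T" for y y'
    using arg_cong[OF eq, of "\<lambda>M. M $ y $ y'"] by (simp split: if_splits)
  then show "S = T" by auto
qed

lemma matrix_eq_sum_ind_mat:
  fixes M :: "real^'y::finite^'y"
  shows "M = (\<Sum>e\<in>UNIV. (M $ fst e $ snd e) *\<^sub>R ind_mat {e})"
proof -
  have "(\<Sum>e\<in>UNIV. (M $ fst e $ snd e) *\<^sub>R (ind_mat {e} :: real^'y^'y)) $ y $ y' = M $ y $ y'"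
    for y y'
  proof -
    have "(\<Sum>e\<in>UNIV. (M $ fst e $ snd e) *\<^sub>R (ind_mat {e} :: real^'y^'y)) $ y $ y'
        = (\<Sum>e\<in>UNIV. if (y, y') = e then M $ fst e $ snd e else 0)"
      unfolding sum_component by (intro sum.cong) auto
    then show ?thesis by simp
  qed
  then show ?thesis by (simp add: vec_eq_iff)
qed

lemma supported_in_span_ind_mat:
  fixes M :: "real^'y::finite^'y"
  assumes "\<And>y y'. (y, y') \<notin> R \<Longrightarrow> M $ y $ y' = 0"
    and "\<And>e. e \<in> R \<Longrightarrow> ind_mat {e} \<in> span S"
  shows "M \<in> span S"
proof -
  have "(M $ fst e $ snd e) *\<^sub>R ind_mat {e} \<in> span S" for e
  proof (cases "e \<in> R")
    case True
    then show ?thesis by (intro span_scale assms(2))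
  next
    case False
    then show ?thesis using assms(1)[of "fst e" "snd e"] by (simp add: span_zero)
  qed
  then show ?thesis
    by (subst matrix_eq_sum_ind_mat) (intro span_sum)
qed

section \<open>Edges, blocks and anchors\<close>

lemma mem_fib [simp]: "y \<in> fib \<kappa> x \<longleftrightarrow> \<kappa> y = x"
  by (simp add: fib_def)

lemma R_edges_iff:
  "(y, y') \<in> R_edges \<kappa> E \<longleftrightarrow> (y, y') \<in> E \<and> y \<in> multi_rows \<kappa> E (\<kappa> y) (\<kappa> y')"
proof
  assume "(y, y') \<in> R_edges \<kappa> E"
  then obtain x x' where "y \<in> multi_rows \<kappa> E x x'" "\<kappa> y' = x'" "(y, y') \<in> E"
    unfolding R_edges_def by auto
  moreover from this have "\<kappa> y = x" by (simp add: multi_rows_def)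
  ultimately show "(y, y') \<in> E \<and> y \<in> multi_rows \<kappa> E (\<kappa> y) (\<kappa> y')" by simp
next
  assume a: "(y, y') \<in> E \<and> y \<in> multi_rows \<kappa> E (\<kappa> y) (\<kappa> y')"
  then have "(\<kappa> y, \<kappa> y') \<in> M_pairs \<kappa> E"
    unfolding M_pairs_def lumped_edges_def by blast
  with a show "(y, y') \<in> R_edges \<kappa> E"
    unfolding R_edges_def by (intro UN_I[of "(\<kappa> y, \<kappa> y')"]) simp_all
qed

lemma anchor_subset:
  assumes "anchor_choice \<kappa> E A" "(x, x') \<in> lumped_edges \<kappa> E" "(y, y') \<in> A x x'"
  shows "(y, y') \<in> E" "\<kappa> y = x" "\<kappa> y' = x'"
proof -
  have "A x x' \<subseteq> E \<inter> (fib \<kappa> x \<times> fib \<kappa> x')"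
    using assms(1,2) unfolding anchor_choice_def by blast
  then have "(y, y') \<in> E \<inter> (fib \<kappa> x \<times> fib \<kappa> x')" using assms(3) by (rule subsetD)
  then show "(y, y') \<in> E" "\<kappa> y = x" "\<kappa> y' = x'" by simp_all
qed

lemma anchor_in_row:
  assumes "anchor_choice \<kappa> E A" "(x, x') \<in> lumped_edges \<kappa> E" "\<kappa> y = x"
  obtains y' where "(y, y') \<in> A x x'"
proof -
  have "\<forall>y \<in> fib \<kappa> x. \<exists>!e. e \<in> A x x' \<and> fst e = y"
    using assms(1,2) unfolding anchor_choice_def by blast
  then have "\<exists>e. e \<in> A x x' \<and> fst e = y"
    using assms(3) by (meson mem_fib ex1_implies_ex)
  then show ?thesis using that by (metis prod.collapse)
qed

text \<open>
  The anchor set has an edge in every row of its block, and a row outside \<open>R_edges\<close> offers only one.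
\<close>
lemma edge_outside_R:
  assumes A: "anchor_choice \<kappa> E A" and e: "(y, y') \<in> E" and R: "(y, y') \<notin> R_edges \<kappa> E"
  shows "(\<kappa> y, \<kappa> y') \<in> U_pairs \<kappa> E"
    and "(y, y') \<in> A (\<kappa> y) (\<kappa> y')"
    and "\<And>z. (y, z) \<in> E \<Longrightarrow> \<kappa> z = \<kappa> y' \<Longrightarrow> z = y'"
proof -
  have D: "(\<kappa> y, \<kappa> y') \<in> lumped_edges \<kappa> E"
    using e by (auto simp: lumped_edges_def)
  have nm: "y \<notin> multi_rows \<kappa> E (\<kappa> y) (\<kappa> y')"
    using R e by (simp add: R_edges_iff)
  moreover have "y \<in> fib \<kappa> (\<kappa> y)" by simp
  ultimately show "(\<kappa> y, \<kappa> y') \<in> U_pairs \<kappa> E"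
    using D unfolding U_pairs_def by blast
  show uniq: "z = y'" if "(y, z) \<in> E" "\<kappa> z = \<kappa> y'" for z
    using nm e that unfolding multi_rows_def by (auto; metis mem_fib)
  obtain z where z: "(y, z) \<in> A (\<kappa> y) (\<kappa> y')"
    using anchor_in_row[OF A D] by blast
  then show "(y, y') \<in> A (\<kappa> y) (\<kappa> y')"
    using uniq anchor_subset[OF A D z] by auto
qed

lemma anchor_private_edge:
  assumes A: "anchor_choice \<kappa> E A" and U: "(x, x') \<in> U_pairs \<kappa> E"
  obtains y y' where "(y, y') \<in> A x x'" "(y, y') \<notin> R_edges \<kappa> E"
proof -
  have D: "(x, x') \<in> lumped_edges \<kappa> E" using U by (simp add: U_pairs_def)
  have "multi_rows \<kappa> E x x' \<noteq> fib \<kappa> x" using U by (simp add: U_pairs_def)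
  moreover have "multi_rows \<kappa> E x x' \<subseteq> fib \<kappa> x" by (auto simp: multi_rows_def)
  ultimately obtain y where y: "\<kappa> y = x" "y \<notin> multi_rows \<kappa> E x x'"
    by (metis mem_fib subset_antisym subsetI)
  obtain y' where y': "(y, y') \<in> A x x'" using anchor_in_row[OF A D y(1)] .
  have "(y, y') \<notin> R_edges \<kappa> E"
    using anchor_subset[OF A D y'] y by (simp add: R_edges_iff)
  with y' show ?thesis using that by blast
qed

lemma row_sum_eq:
  fixes F :: "real^'y::finite^'y"
  assumes "F \<in> pos_lumpable \<kappa> E" "(\<kappa> y, x') \<in> lumped_edges \<kappa> E" "\<kappa> z = \<kappa> y"
  shows "(\<Sum>y'\<in>fib \<kappa> x'. F $ z $ y') = (\<Sum>y'\<in>fib \<kappa> x'. F $ y $ y')"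
proof -
  have "lumpable \<kappa> E F" "z \<in> fib \<kappa> (\<kappa> y)" "y \<in> fib \<kappa> (\<kappa> y)"
    using assms by (simp_all add: pos_lumpable_def)
  then show ?thesis using assms(2) unfolding lumpable_def by blast
qed

section \<open>The span of the logarithms of lumpable functions\<close>

text \<open>
  The values \<open>a\<close> and \<open>b\<close> have to share the mass that \<open>F\<close> puts on the two edges, so that no row sum
  over a fibre changes.
\<close>
lemma redistribute_pos_lumpable:
  fixes F :: "real^'y::finite^'y"
  assumes F: "F \<in> pos_lumpable \<kappa> E"
    and e: "(y, y1) \<in> E" "(y, y2) \<in> E" "y1 \<noteq> y2" "\<kappa> y1 = \<kappa> y2"
    and ab: "a > 0" "b > 0" "a + b = F $ y $ y1 + F $ y $ y2"
  shows "F + (a - F $ y $ y1) *\<^sub>R ind_mat {(y, y1)} + (b - F $ y $ y2) *\<^sub>R ind_mat {(y, y2)}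
    \<in> pos_lumpable \<kappa> E" (is "?G \<in> _")
proof -
  have row: "(\<Sum>z'\<in>fib \<kappa> x'. ?G $ z $ z') = (\<Sum>z'\<in>fib \<kappa> x'. F $ z $ z')" for z x'
  proof -
    have d: "(\<Sum>z'\<in>fib \<kappa> x'. c *\<^sub>R ind_mat {(y, w)} $ z $ z')
        = (if z = y \<and> \<kappa> w = x' then c else 0)" for c :: real and w
    proof -
      have "(\<Sum>z'\<in>fib \<kappa> x'. c *\<^sub>R ind_mat {(y, w)} $ z $ z')
          = (\<Sum>z'\<in>fib \<kappa> x'. if w = z' then (if z = y then c else 0) else 0)"
        by (intro sum.cong) auto
      then show ?thesis by simp
    qed
    show ?thesis
      using e ab d[of "a - F $ y $ y1" y1] d[of "b - F $ y $ y2" y2]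
      by (simp add: sum.distrib)
  qed
  have "lumpable \<kappa> E ?G"
    using F unfolding lumpable_def row by (simp add: pos_lumpable_def lumpable_def)
  moreover have "?G \<in> pos_edge_funs E"
    using F e ab by (auto simp: pos_lumpable_def pos_edge_funs_def edge_funs_def)
  ultimately show ?thesis by (simp add: pos_lumpable_def)
qed

text \<open>
  Split the mass \<open>s\<close> of two edges of one row in the proportions 1:3, 2:2 and 3:1.  The differences of
  logarithms are \<open>(ln 2, - ln (3/2))\<close> and \<open>(- ln (3/2), ln 2)\<close> in these two coordinates, and their
  determinant does not vanish because \<open>ln (3/2) < ln 2\<close>.
\<close>
lemma ind_mat_R_edge_in_span_log:
  fixes F :: "real^'y::finite^'y"
  assumes F: "F \<in> pos_lumpable \<kappa> E" and R: "(y, y1) \<in> R_edges \<kappa> E"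
  shows "ind_mat {(y, y1)} \<in> span (log_lumpable \<kappa> E)"
proof -
  obtain y2 where e: "(y, y1) \<in> E" "(y, y2) \<in> E" "y1 \<noteq> y2" "\<kappa> y1 = \<kappa> y2"
    using R unfolding R_edges_iff multi_rows_def by (auto; metis)
  define s where "s = F $ y $ y1 + F $ y $ y2"
  have s: "s > 0"
    using F e by (auto simp: s_def pos_lumpable_def pos_edge_funs_def intro: add_pos_pos)
  define G where "G t = F + (t * s - F $ y $ y1) *\<^sub>R ind_mat {(y, y1)}
      + ((1 - t) * s - F $ y $ y2) *\<^sub>R ind_mat {(y, y2)}" for t
  have G: "log_on E (G t) \<in> span (log_lumpable \<kappa> E)" if "0 < t" "t < 1" for t
  proof -
    have "G t \<in> pos_lumpable \<kappa> E"
      unfolding G_def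
    proof (rule redistribute_pos_lumpable[OF F e])
      show "t * s + (1 - t) * s = F $ y $ y1 + F $ y $ y2"
        by (simp add: s_def algebra_simps)
    qed (use that s in auto)
    then show ?thesis by (auto simp: log_lumpable_def intro: span_base)
  qed
  have diff: "log_on E (G t) - log_on E (G u)
      = (ln t - ln u) *\<^sub>R ind_mat {(y, y1)} + (ln (1 - t) - ln (1 - u)) *\<^sub>R ind_mat {(y, y2)}"
    if "0 < t" "t < 1" "0 < u" "u < 1" for t u
    using that s e by (auto simp: vec_eq_iff log_on_def G_def ln_mult)
  define k :: real where "k = ln (3/2)"
  have k: "0 < k" "k < ln 2" by (simp_all add: k_def)
  have lns: "ln (1/2) - ln (1/4) = ln (2::real)" "ln (1/2) - ln (3/4) = - k"
    by (simp_all add: k_def ln_div flip: ln_realpow)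
      (use ln_realpow[of "2::real" 2] in simp_all)
  define d1 where "d1 = log_on E (G (1/2)) - log_on E (G (1/4))"
  define d2 where "d2 = log_on E (G (1/2)) - log_on E (G (3/4))"
  have d: "d1 = ln 2 *\<^sub>R ind_mat {(y, y1)} - k *\<^sub>R ind_mat {(y, y2)}"
    "d2 = - k *\<^sub>R ind_mat {(y, y1)} + ln 2 *\<^sub>R ind_mat {(y, y2)}"
    unfolding d1_def d2_def by (simp_all add: diff lns)
  have "ln 2 *\<^sub>R d1 + k *\<^sub>R d2 = (ln 2 * ln 2 - k * k) *\<^sub>R ind_mat {(y, y1)}"
    unfolding d by (simp add: algebra_simps)
  moreover have "ln 2 *\<^sub>R d1 + k *\<^sub>R d2 \<in> span (log_lumpable \<kappa> E)"
    unfolding d1_def d2_def by (intro span_add span_scale span_diff G) auto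
  moreover have "k * k < ln 2 * ln 2" using k by (intro mult_strict_mono) auto
  ultimately show ?thesis
    using span_scale[of "ln 2 *\<^sub>R d1 + k *\<^sub>R d2" _ "inverse (ln 2 * ln 2 - k * k)"] by simp
qed

text \<open>
  Multiplying a block by a constant preserves lumpability and adds a constant to the logarithm there.
\<close>
lemma ind_mat_block_in_span_log:
  fixes F :: "real^'y::finite^'y"
  assumes F: "F \<in> pos_lumpable \<kappa> E"
  shows "ind_mat (E \<inter> fib \<kappa> x \<times> fib \<kappa> x') \<in> span (log_lumpable \<kappa> E)"
proof -
  define G :: "real^'y^'y"
    where "G = (\<chi> y y'. (if \<kappa> y = x \<and> \<kappa> y' = x' then exp 1 else 1) * F $ y $ y')"
  have row: "(\<Sum>z'\<in>fib \<kappa> w'. G $ z $ z')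
      = (if \<kappa> z = x \<and> w' = x' then exp 1 else 1) * (\<Sum>z'\<in>fib \<kappa> w'. F $ z $ z')" for z w'
    unfolding sum_distrib_left by (intro sum.cong) (auto simp: G_def)
  have "lumpable \<kappa> E G"
    unfolding lumpable_def row
  proof (clarify)
    fix w w' y z assume "(w, w') \<in> lumped_edges \<kappa> E" "y \<in> fib \<kappa> w" "z \<in> fib \<kappa> w"
    then show "(if \<kappa> y = x \<and> w' = x' then exp 1 else 1) * (\<Sum>y'\<in>fib \<kappa> w'. F $ y $ y')
        = (if \<kappa> z = x \<and> w' = x' then exp 1 else 1) * (\<Sum>y'\<in>fib \<kappa> w'. F $ z $ y')"
      using row_sum_eq[OF F, of z w' y] by simp
  qed
  moreover have "G \<in> pos_edge_funs E"
    using F by (auto simp: G_def pos_lumpable_def pos_edge_funs_def edge_funs_def)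
  ultimately have "G \<in> pos_lumpable \<kappa> E" by (simp add: pos_lumpable_def)
  then have "log_on E G - log_on E F \<in> span (log_lumpable \<kappa> E)"
    using F by (intro span_diff span_base) (auto simp: log_lumpable_def)
  moreover have "log_on E G - log_on E F = ind_mat (E \<inter> fib \<kappa> x \<times> fib \<kappa> x')"
  proof -
    have "F $ y $ y' \<noteq> 0 \<and> F $ y $ y' > 0" if "(y, y') \<in> E" for y y'
      using F that by (force simp: pos_lumpable_def pos_edge_funs_def)
    then show ?thesis
      by (auto simp: vec_eq_iff log_on_def G_def ln_mult)
  qed
  ultimately show ?thesis by simp
qed

text \<open>
  The edges of a block that are not anchors lie in rows with several edges, so the indicator of the
  anchor set differs from that of the block by a function supported on \<open>R_edges\<close>.
\<close>
lemma ind_mat_anchor_in_span_log: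
  fixes F :: "real^'y::finite^'y"
  assumes F: "F \<in> pos_lumpable \<kappa> E" and A: "anchor_choice \<kappa> E A"
    and D: "(x, x') \<in> lumped_edges \<kappa> E"
  shows "ind_mat (A x x') \<in> span (log_lumpable \<kappa> E)"
proof -
  let ?B = "ind_mat (E \<inter> fib \<kappa> x \<times> fib \<kappa> x') :: real^'y^'y"
  have "?B - ind_mat (A x x') \<in> span (log_lumpable \<kappa> E)"
  proof (rule supported_in_span_ind_mat[where R = "R_edges \<kappa> E"])
    fix y y' assume R: "(y, y') \<notin> R_edges \<kappa> E"
    show "(?B - ind_mat (A x x')) $ y $ y' = 0"
      using edge_outside_R(2)[OF A _ R] anchor_subset[OF A D, of y y'] by auto
  next
    fix e assume "e \<in> R_edges \<kappa> E"
    then show "ind_mat {e} \<in> span (log_lumpable \<kappa> E)"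
      using ind_mat_R_edge_in_span_log[OF F] by (cases e) auto
  qed
  from span_diff[OF ind_mat_block_in_span_log[OF F, of x x'] this] show ?thesis by simp
qed

text \<open>
  On an edge outside \<open>R_edges\<close> the value of \<open>F\<close> is the common row sum \<open>c\<close> of its block, so the
  anchor indicators with coefficients \<open>ln c\<close> account for \<open>log F\<close> there.
\<close>
lemma log_in_span_lump_basis:
  fixes \<kappa> :: "'y::finite \<Rightarrow> 'x::finite" and F :: "real^'y::finite^'y"
  assumes F: "F \<in> pos_lumpable \<kappa> E" and A: "anchor_choice \<kappa> E A"
  shows "log_on E F \<in> span (lump_basis \<kappa> E A)"
proof -
  \<comment> \<open>The representative row is immaterial by lumpability; \<open>inv \<kappa>\<close> picks one in each nonempty fibre.\<close>
  define c where "c p = (\<Sum>z'\<in>fib \<kappa> (snd p). F $ inv \<kappa> (fst p) $ z')" for p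
  define M where "M = (\<Sum>p\<in>U_pairs \<kappa> E. ln (c p) *\<^sub>R (ind_mat (A (fst p) (snd p)) :: real^'y^'y))"
  have M: "M \<in> span (lump_basis \<kappa> E A)"
    unfolding M_def
    by (intro span_sum span_scale span_base) (auto simp: lump_basis_def)
  have "log_on E F - M \<in> span (lump_basis \<kappa> E A)"
  proof (rule supported_in_span_ind_mat[where R = "R_edges \<kappa> E"])
    fix e assume "e \<in> R_edges \<kappa> E"
    then show "ind_mat {e} \<in> span (lump_basis \<kappa> E A)"
      by (intro span_base) (cases e; auto simp: lump_basis_def)
  next
    fix y y' assume R: "(y, y') \<notin> R_edges \<kappa> E"
    let ?p = "(\<kappa> y, \<kappa> y')"
    have "M $ y $ y' = (\<Sum>p\<in>U_pairs \<kappa> E. ln (c p) * (if (y, y') \<in> A (fst p) (snd p) then 1 else 0))"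
      by (simp add: M_def)
    also have "\<dots> = (\<Sum>p\<in>U_pairs \<kappa> E. if ?p = p then (if (y, y') \<in> E then ln (c p) else 0) else 0)"
    proof (intro sum.cong refl)
      fix p assume "p \<in> U_pairs \<kappa> E"
      then have D: "(fst p, snd p) \<in> lumped_edges \<kappa> E" by (auto simp: U_pairs_def)
      have "(y, y') \<in> A (fst p) (snd p) \<longleftrightarrow> ?p = p \<and> (y, y') \<in> E"
        using anchor_subset[OF A D, of y y'] edge_outside_R(2)[OF A _ R] by auto
      then show "ln (c p) * (if (y, y') \<in> A (fst p) (snd p) then 1 else 0)
          = (if ?p = p then (if (y, y') \<in> E then ln (c p) else 0) else 0)"
        by simp
    qed
    also have "\<dots> = (if (y, y') \<in> E then ln (c ?p) else 0)"
      using edge_outside_R(1)[OF A _ R] by (cases "(y, y') \<in> E") simp_all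
    also have "\<dots> = log_on E F $ y $ y'"
    proof (cases "(y, y') \<in> E")
      case e: True
      have "?p \<in> lumped_edges \<kappa> E" using e by (auto simp: lumped_edges_def)
      moreover have "\<kappa> (inv \<kappa> (\<kappa> y)) = \<kappa> y" by (simp add: f_inv_into_f)
      ultimately have "c ?p = (\<Sum>z'\<in>fib \<kappa> (\<kappa> y'). F $ y $ z')"
        unfolding c_def fst_conv snd_conv by (rule row_sum_eq[OF F])
      also have "\<dots> = (\<Sum>z'\<in>{y'}. F $ y $ z')"
      proof (intro sum.mono_neutral_right ballI)
        fix z assume z: "z \<in> fib \<kappa> (\<kappa> y') - {y'}"
        then have "(y, z) \<notin> E" using edge_outside_R(3)[OF A e R, of z] by auto
        then show "F $ y $ z = 0"
          using F by (simp add: pos_lumpable_def pos_edge_funs_def edge_funs_def)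
      qed auto
      finally show ?thesis using e by (simp add: log_on_def)
    qed (simp add: log_on_def)
    finally show "(log_on E F - M) $ y $ y' = 0" by simp
  qed
  from span_add[OF this M] show ?thesis by simp
qed

lemma span_lump_basis:
  fixes \<kappa> :: "'y::finite \<Rightarrow> 'x::finite" and F :: "real^'y::finite^'y"
  assumes F: "F \<in> pos_lumpable \<kappa> E" and A: "anchor_choice \<kappa> E A"
  shows "span (lump_basis \<kappa> E A) = span (log_lumpable \<kappa> E)"
proof (rule antisym)
  have "lump_basis \<kappa> E A \<subseteq> span (log_lumpable \<kappa> E)"
    using ind_mat_anchor_in_span_log[OF F A] ind_mat_R_edge_in_span_log[OF F]
    by (auto simp: lump_basis_def U_pairs_def)
  then show "span (lump_basis \<kappa> E A) \<subseteq> span (log_lumpable \<kappa> E)"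
    by (simp add: span_minimal)
  have "log_lumpable \<kappa> E \<subseteq> span (lump_basis \<kappa> E A)"
    using log_in_span_lump_basis[OF _ A] by (auto simp: log_lumpable_def)
  then show "span (log_lumpable \<kappa> E) \<subseteq> span (lump_basis \<kappa> E A)"
    by (simp add: span_minimal)
qed

section \<open>Independence and cardinality\<close>

text \<open>
  Each element is separated from the others by a linear condition that they satisfy and it violates.  For
  an anchor set the condition is the vanishing of the entry at a private edge.  For an edge of
  \<open>R_edges\<close> inside an anchor set it is the equality of the entries there and at the private edge of this
  anchor set.
\<close>
lemma independent_lump_basis:
  fixes \<kappa> :: "'y::finite \<Rightarrow> 'x::finite"
  assumes A: "anchor_choice \<kappa> E A"
  shows "independent (lump_basis \<kappa> E A)"
  unfolding dependent_def
proof (safe)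
  fix b assume b: "b \<in> lump_basis \<kappa> E A" and sp: "b \<in> span (lump_basis \<kappa> E A - {b})"
  have separated: False
    if "subspace {M. P M}" "\<not> P b"
      "\<And>x x'. (x, x') \<in> U_pairs \<kappa> E \<Longrightarrow> ind_mat (A x x') \<noteq> b \<Longrightarrow> P (ind_mat (A x x'))"
      "\<And>e. e \<in> R_edges \<kappa> E \<Longrightarrow> ind_mat {e} \<noteq> b \<Longrightarrow> P (ind_mat {e})" for P
  proof -
    have "lump_basis \<kappa> E A - {b} \<subseteq> {M. P M}"
      using that(3,4) by (auto simp: lump_basis_def)
    then have "b \<in> {M. P M}" using sp that(1) span_minimal by blast
    with that(2) show False by simp
  qed
  have sub: "subspace {M :: real^'y^'y. M $ y $ y' = 0}"
    "subspace {M :: real^'y^'y. M $ y $ y' = M $ z $ z'}" for y y' z z'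
    by (auto simp: subspace_def)
  have UD: "(x, x') \<in> lumped_edges \<kappa> E" if "(x, x') \<in> U_pairs \<kappa> E" for x x'
    using that by (auto simp: U_pairs_def)
  have disj: "x = w \<and> x' = w'"
    if "(x, x') \<in> U_pairs \<kappa> E" "(w, w') \<in> U_pairs \<kappa> E" "(y, y') \<in> A x x'" "(y, y') \<in> A w w'"
    for x x' w w' y y'
    using anchor_subset[OF A UD[OF that(1)] that(3)] anchor_subset[OF A UD[OF that(2)] that(4)]
    by auto
  from b consider (U) x x' where "(x, x') \<in> U_pairs \<kappa> E" "b = ind_mat (A x x')"
    | (R) y y' where "(y, y') \<in> R_edges \<kappa> E" "b = ind_mat {(y, y')}"
    by (auto simp: lump_basis_def)
  then show False
  proof cases
    case U
    obtain y y' where q: "(y, y') \<in> A x x'" "(y, y') \<notin> R_edges \<kappa> E"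
      using anchor_private_edge[OF A U(1)] .
    show False
    proof (rule separated[OF sub(1)[of y y']])
      show "b $ y $ y' \<noteq> 0" using U q by simp
      fix w w' assume w: "(w, w') \<in> U_pairs \<kappa> E" "ind_mat (A w w') \<noteq> b"
      then have "(y, y') \<notin> A w w'" using U(2) disj[OF U(1) w(1) q(1)] by auto
      then show "(ind_mat (A w w') :: real^'y^'y) $ y $ y' = 0" by simp
    qed (use q in auto)
  next
    case R
    show False
    proof (cases "\<exists>x x'. (x, x') \<in> U_pairs \<kappa> E \<and> (y, y') \<in> A x x'")
      case True
      then obtain x x' where x: "(x, x') \<in> U_pairs \<kappa> E" "(y, y') \<in> A x x'" by blast
      obtain z z' where q: "(z, z') \<in> A x x'" "(z, z') \<notin> R_edges \<kappa> E"
        using anchor_private_edge[OF A x(1)] .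
      show False
      proof (rule separated[OF sub(2)[of y y' z z']])
        show "b $ y $ y' \<noteq> b $ z $ z'" using R q by auto
        fix w w' assume w: "(w, w') \<in> U_pairs \<kappa> E"
        have "(y, y') \<in> A w w' \<longleftrightarrow> (z, z') \<in> A w w'"
          using disj[OF x(1) w x(2)] disj[OF x(1) w q(1)] x(2) q(1) by auto
        then show "(ind_mat (A w w') :: real^'y^'y) $ y $ y' = ind_mat (A w w') $ z $ z'" by simp
      qed (use R q in auto)
    next
      case False
      show False
      proof (rule separated[OF sub(1)[of y y']])
        show "b $ y $ y' \<noteq> 0" using R by simp
      qed (use R False in auto)
    qed
  qed
qed

lemma card_lump_basis:
  fixes \<kappa> :: "'y::finite \<Rightarrow> 'x::finite"
  assumes A: "anchor_choice \<kappa> E A"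
  shows "card (lump_basis \<kappa> E A) = card (U_pairs \<kappa> E) + card (R_edges \<kappa> E)"
proof -
  let ?S = "(\<lambda>p. A (fst p) (snd p)) ` U_pairs \<kappa> E" and ?T = "(\<lambda>e. {e}) ` R_edges \<kappa> E"
  have UD: "(fst p, snd p) \<in> lumped_edges \<kappa> E" if "p \<in> U_pairs \<kappa> E" for p
    using that by (auto simp: U_pairs_def)
  have "lump_basis \<kappa> E A = ind_mat ` (?S \<union> ?T)"
    unfolding lump_basis_def image_Un image_image
  proof (intro arg_cong2[where f = "(\<union>)"])
    show "{ind_mat (A x x') | x x'. (x, x') \<in> U_pairs \<kappa> E}
        = (\<lambda>p. ind_mat (A (fst p) (snd p)) :: real^'y^'y) ` U_pairs \<kappa> E"
      by (simp add: setcompr_eq_image image_def Bex_def set_eq_iff) blast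
  qed auto
  then have "card (lump_basis \<kappa> E A) = card (?S \<union> ?T)"
    by (simp add: card_image inj_on_subset[OF inj_ind_mat])
  also have "\<dots> = card ?S + card ?T"
  proof (intro card_Un_disjoint)
    have "A x x' \<noteq> {e}" if "(x, x') \<in> U_pairs \<kappa> E" "e \<in> R_edges \<kappa> E" for x x' e
      using anchor_private_edge[OF A that(1)] that(2) by (metis singletonD)
    then show "?S \<inter> ?T = {}" by auto
  qed auto
  also have "card ?S = card (U_pairs \<kappa> E)"
  proof (intro card_image inj_onI)
    fix p r assume p: "p \<in> U_pairs \<kappa> E" and r: "r \<in> U_pairs \<kappa> E"
      and eq: "A (fst p) (snd p) = A (fst r) (snd r)"
    obtain y y' where q: "(y, y') \<in> A (fst p) (snd p)"
      using anchor_private_edge[OF A] p by (metis prod.collapse)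
    show "p = r"
      using anchor_subset[OF A UD[OF p] q] anchor_subset[OF A UD[OF r], of y y'] q eq
      by (auto simp: prod_eq_iff)
  qed
  also have "card ?T = card (R_edges \<kappa> E)"
    by (simp add: card_image)
  finally show ?thesis .
qed

theorem proposition4p2:
  fixes \<kappa> :: "'y::finite \<Rightarrow> 'x::finite"
    and E :: "('y \<times> 'y) set"
    and A :: "'x \<Rightarrow> 'x \<Rightarrow> ('y \<times> 'y) set"
  assumes "E \<noteq> {}"
    and "strongly_connected_on_UNIV E"
    and "surj \<kappa>"
    and "1 < CARD('x)" and "CARD('x) < CARD('y)"
    and "stoch_lumpable \<kappa> E \<noteq> {}"
    and "anchor_choice \<kappa> E A"
  shows "independent (lump_basis \<kappa> E A)
    \<and> span (lump_basis \<kappa> E A) = span (log_lumpable \<kappa> E)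
    \<and> dim (span (log_lumpable \<kappa> E)) = card (U_pairs \<kappa> E) + card (R_edges \<kappa> E)"
proof -
  obtain F where "F \<in> pos_lumpable \<kappa> E"
    using assms(6) by (auto simp: stoch_lumpable_def stoch_edge_funs_def pos_lumpable_def)
  then have span: "span (lump_basis \<kappa> E A) = span (log_lumpable \<kappa> E)"
    using span_lump_basis assms(7) by blast
  have ind: "independent (lump_basis \<kappa> E A)"
    using independent_lump_basis assms(7) .
  have "dim (span (log_lumpable \<kappa> E)) = card (lump_basis \<kappa> E A)"
    using dim_span_eq_card_independent[OF ind] span by simp
  with ind span card_lump_basis[OF assms(7)] show ?thesis by simp
qed

end
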